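(* Let $\mathcal{I}$ be a proper ideal on a set $X$. Then $\mathcal{I}$ is a maximal ideal if and only if $A\in\mathcal{I}$ or $X\setminus A\in\mathcal{I}$ for all $A\subseteq X$.
   Context: An ideal on a set $X$ is a non-empty family $\mathcal{I}\subseteq 2^X$ ($2^X$ is the power set of $X$) such that (i) $A\in\mathcal{I}$ and $B\subseteq A$ imply $B\in\mathcal{I}$, and (ii) $A,B\in\mathcal{I}$ imply $A\cup B\in\mathcal{I}$. An ideal $\mathcal{I}$ is proper if $\mathcal{I}\neq 2^X$. A proper ideal $\mathcal{I}$ on $X$ is a maximal ideal if for every ideal $\mathcal{J}$ on $X$ with $\mathcal{I}\subseteq\mathcal{J}$, one has $\mathcal{I}=\mathcal{J}$ or $\mathcal{J}=2^X$. *)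

theory Defs
  imports Main
begin

definition ideal_on :: "'a set \<Rightarrow> 'a set set \<Rightarrow> bool" where
  "ideal_on X I \<longleftrightarrow>
     I \<noteq> {} \<and> I \<subseteq> Pow X \<and>
     (\<forall>A B. A \<in> I \<and> B \<subseteq> A \<longrightarrow> B \<in> I) \<and>
     (\<forall>A B. A \<in> I \<and> B \<in> I \<longrightarrow> A \<union> B \<in> I)"

definition proper_ideal_on :: "'a set \<Rightarrow> 'a set set \<Rightarrow> bool" where
  "proper_ideal_on X I \<longleftrightarrow> ideal_on X I \<and> I \<noteq> Pow X"

definition maximal_ideal_on :: "'a set \<Rightarrow> 'a set set \<Rightarrow> bool" where
  "maximal_ideal_on X I \<longleftrightarrow>
     proper_ideal_on X I \<and>
     (\<forall>J. ideal_on X J \<and> I \<subseteq> J \<longrightarrow> I = J \<or> J = Pow X)"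

end

theory Submission
  imports Defs
begin

text \<open>
  If \<open>I\<close> is maximal and \<open>A \<subseteq> X\<close>, enlarge \<open>I\<close> by \<open>A\<close>: the subsets of \<open>X\<close> that lie in \<open>I\<close> up to
  a part of \<open>A\<close> form an ideal containing \<open>I\<close> and \<open>A\<close>. By maximality this ideal is either \<open>I\<close>,
  which puts \<open>A\<close> into \<open>I\<close>, or the whole power set, and then it contains \<open>X\<close>, which says exactly
  that \<open>X - A \<in> I\<close>. Conversely, an ideal strictly above \<open>I\<close> contains some \<open>A \<notin> I\<close>; if \<open>X - A \<in> I\<close>,
  it also contains \<open>X = A \<union> (X - A)\<close> and hence every subset of \<open>X\<close>.
\<close>

lemma ideal_on_downward: "ideal_on X I \<Longrightarrow> A \<in> I \<Longrightarrow> B \<subseteq> A \<Longrightarrow> B \<in> I"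
  unfolding ideal_on_def by blast

lemma ideal_on_Un: "ideal_on X I \<Longrightarrow> A \<in> I \<Longrightarrow> B \<in> I \<Longrightarrow> A \<union> B \<in> I"
  unfolding ideal_on_def by blast

lemma ideal_on_subset: "ideal_on X I \<Longrightarrow> A \<in> I \<Longrightarrow> A \<subseteq> X"
  unfolding ideal_on_def by blast

lemma ideal_on_empty: "ideal_on X I \<Longrightarrow> {} \<in> I"
  unfolding ideal_on_def by blast

lemma ideal_on_eq_Pow_iff:
  assumes "ideal_on X I"
  shows "I = Pow X \<longleftrightarrow> X \<in> I"
  using ideal_on_downward[OF assms] ideal_on_subset[OF assms] by blast

text \<open>
  For \<open>A \<subseteq> X\<close> this is the ideal generated by \<open>I\<close> and \<open>A\<close>. Describing it through \<open>B - A\<close>, rather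
  than as the sets covered by \<open>A\<close> and a member of \<open>I\<close>, makes membership of \<open>X\<close> the condition
  \<open>X - A \<in> I\<close>.
\<close>
definition adjoin :: "'a set \<Rightarrow> 'a set set \<Rightarrow> 'a set \<Rightarrow> 'a set set" where
  "adjoin X I A = {B. B \<subseteq> X \<and> B - A \<in> I}"

text \<open>Both closure properties are inherited from \<open>I\<close>, since removing \<open>A\<close> preserves inclusions
  and commutes with unions.\<close>
lemma ideal_on_adjoin:
  assumes I: "ideal_on X I"
  shows "ideal_on X (adjoin X I A)"
  unfolding ideal_on_def
proof (intro conjI allI impI)
  show "adjoin X I A \<noteq> {}"
    using ideal_on_empty[OF I] by (auto simp: adjoin_def intro: exI[of _ "{}"])
  show "adjoin X I A \<subseteq> Pow X"
    by (auto simp: adjoin_def)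
next
  fix B C assume "B \<in> adjoin X I A \<and> C \<subseteq> B"
  then have "C \<subseteq> X" "B - A \<in> I" "C - A \<subseteq> B - A"
    by (auto simp: adjoin_def)
  then show "C \<in> adjoin X I A"
    using ideal_on_downward[OF I] by (auto simp: adjoin_def)
next
  fix B C assume "B \<in> adjoin X I A \<and> C \<in> adjoin X I A"
  then show "B \<union> C \<in> adjoin X I A"
    using ideal_on_Un[OF I] by (simp add: adjoin_def Un_Diff)
qed

lemma subset_adjoin:
  assumes "ideal_on X I"
  shows "I \<subseteq> adjoin X I A"
  using ideal_on_subset[OF assms] ideal_on_downward[OF assms]
  by (auto simp: adjoin_def)

lemma mem_adjoin:
  assumes "ideal_on X I" and "A \<subseteq> X"
  shows "A \<in> adjoin X I A"
  using assms ideal_on_empty by (auto simp: adjoin_def)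

theorem theorem3p3:
  fixes X :: "'a set" and I :: "'a set set"
  assumes "proper_ideal_on X I"
  shows "maximal_ideal_on X I \<longleftrightarrow> (\<forall>A. A \<subseteq> X \<longrightarrow> A \<in> I \<or> X - A \<in> I)"
proof
  have I: "ideal_on X I"
    using assms by (simp add: proper_ideal_on_def)
  {
    assume max: "maximal_ideal_on X I"
    show "\<forall>A. A \<subseteq> X \<longrightarrow> A \<in> I \<or> X - A \<in> I"
    proof (intro allI impI)
      fix A assume A: "A \<subseteq> X"
      have "I = adjoin X I A \<or> adjoin X I A = Pow X"
        using max ideal_on_adjoin[OF I] subset_adjoin[OF I]
        unfolding maximal_ideal_on_def by blast
      then show "A \<in> I \<or> X - A \<in> I"
      proof
        assume "I = adjoin X I A"
        then show ?thesis using mem_adjoin[OF I A] by simp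
      next
        assume "adjoin X I A = Pow X"
        then have "X \<in> adjoin X I A" by simp
        then show ?thesis by (simp add: adjoin_def)
      qed
    qed
  next
    assume compl: "\<forall>A. A \<subseteq> X \<longrightarrow> A \<in> I \<or> X - A \<in> I"
    have "J = Pow X" if J: "ideal_on X J" and "I \<subseteq> J" and "I \<noteq> J" for J
    proof -
      obtain A where A: "A \<in> J" "A \<notin> I"
        using \<open>I \<subseteq> J\<close> \<open>I \<noteq> J\<close> by blast
      have "A \<subseteq> X" using ideal_on_subset[OF J A(1)] .
      then have "X - A \<in> J" using compl A(2) \<open>I \<subseteq> J\<close> by blast
      then have "A \<union> (X - A) \<in> J" using ideal_on_Un[OF J A(1)] by blast
      then have "X \<in> J" using \<open>A \<subseteq> X\<close> by (simp add: Un_absorb1)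
      then show ?thesis using ideal_on_eq_Pow_iff[OF J] by simp
    qed
    then show "maximal_ideal_on X I"
      using assms unfolding maximal_ideal_on_def by blast
  }
qed

end
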